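(* Let $J\subset\mathbb{R}$ be an interval with $(0,1)\subset J$ and let $h:J\to\mathbb{R}$ be a non-negative supermultiplicative function with $h(\alpha)\ge\alpha$ for all $\alpha\in(0,1)$. Let $I\subset[0,\infty)$ be an interval and let $f:I\to\mathbb{R}$ be differentiable on the interior $I^{\circ}$ of $I$. Let $a,b\in I^{\circ}$ with $a<b$ and suppose $f'\in L[a,b]$. If $|f'|$ is $h$-convex on $I$, then $$\left|\frac{1}{b-a}\int_a^b f(x)\,dx-\frac13\left[\frac{f(a)+f(b)}{2}+2f\left(\frac{a+b}{2}\right)\right]\right|\le(b-a)\left\{|f'(a)|\,A+|f'(b)|\,B\right\},$$ where $$A=\int_0^{\frac16}h\left(t\left[\tfrac16-t\right]\right)dt+\int_{\frac16}^{\frac12}h\left(t\left[t-\tfrac16\right]\right)dt+\int_{\frac12}^{\frac56}h\left(t\left[\tfrac56-t\right]\right)dt+\int_{\frac56}^{1}h\left(t\left[t-\tfrac56\right]\right)dt,$$ $$B=\int_0^{\frac16}h\left((1-t)\left(\tfrac16-t\right)\right)dt+\int_{\frac16}^{\frac12}h\left((1-t)\left(t-\tfrac16\right)\right)dt+\int_{\frac12}^{\frac56}h\left((1-t)\left(\tfrac56-t\right)\right)dt+\int_{\frac56}^{1}h\left((1-t)\left(t-\tfrac56\right)\right)dt.$$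
   Context: A function $g$ is $h$-convex on an interval if $g$ is non-negative and $g(tx+(1-t)y)\le h(t)g(x)+h(1-t)g(y)$ for all $x,y$ in the interval and all $t\in(0,1)$. A function $h:J\to\mathbb{R}$ is supermultiplicative if $h(xy)\ge h(x)h(y)$ for all $x,y\in J$. $L[a,b]$ denotes the Lebesgue integrable functions on $[a,b]$. *)

theory Defs
  imports "HOL-Analysis.Analysis"
begin

definition h_convex_on :: "(real \<Rightarrow> real) \<Rightarrow> real set \<Rightarrow> (real \<Rightarrow> real) \<Rightarrow> bool" where
  "h_convex_on h S g \<longleftrightarrow>
     (\<forall>x\<in>S. 0 \<le> g x) \<and>
     (\<forall>x\<in>S. \<forall>y\<in>S. \<forall>t\<in>{0<..<1}.
        g (t * x + (1 - t) * y) \<le> h t * g x + h (1 - t) * g y)"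

(* J need not be closed under multiplication; the inequality is only required
   where h (x * y) is a value of h on its domain J. *)
definition supermultiplicative_on :: "real set \<Rightarrow> (real \<Rightarrow> real) \<Rightarrow> bool" where
  "supermultiplicative_on J h \<longleftrightarrow>
     (\<forall>x\<in>J. \<forall>y\<in>J. x * y \<in> J \<longrightarrow> h x * h y \<le> h (x * y))"

(* The integrals of the non-negative h may diverge (for instance for h t = 1 / t),
   so they take values in [0, \<infinity>]. The argument of h leaves (0,1) only at
   finitely many t, so values of h outside (0,1) do not matter. *)
definition simpson_A :: "(real \<Rightarrow> real) \<Rightarrow> ennreal" where
  "simpson_A h =
     (\<integral>\<^sup>+t\<in>{0..1/6}. ennreal (h (t * (1/6 - t))) \<partial>lebesgue) +
     (\<integral>\<^sup>+t\<in>{1/6..1/2}. ennreal (h (t * (t - 1/6))) \<partial>lebesgue) +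
     (\<integral>\<^sup>+t\<in>{1/2..5/6}. ennreal (h (t * (5/6 - t))) \<partial>lebesgue) +
     (\<integral>\<^sup>+t\<in>{5/6..1}. ennreal (h (t * (t - 5/6))) \<partial>lebesgue)"

definition simpson_B :: "(real \<Rightarrow> real) \<Rightarrow> ennreal" where
  "simpson_B h =
     (\<integral>\<^sup>+t\<in>{0..1/6}. ennreal (h ((1 - t) * (1/6 - t))) \<partial>lebesgue) +
     (\<integral>\<^sup>+t\<in>{1/6..1/2}. ennreal (h ((1 - t) * (t - 1/6))) \<partial>lebesgue) +
     (\<integral>\<^sup>+t\<in>{1/2..5/6}. ennreal (h ((1 - t) * (5/6 - t))) \<partial>lebesgue) +
     (\<integral>\<^sup>+t\<in>{5/6..1}. ennreal (h ((1 - t) * (t - 5/6))) \<partial>lebesgue)"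

(* Measurability of the eight integrands above: what is needed for these integrals
   to be defined, and nothing more. On a non-measurable integrand nn_integral returns a
   lower integral, which is not additive. *)
definition simpson_integrals_defined :: "(real \<Rightarrow> real) \<Rightarrow> bool" where
  "simpson_integrals_defined h \<longleftrightarrow>
     set_borel_measurable lebesgue {0..1/6} (\<lambda>t. h (t * (1/6 - t))) \<and>
     set_borel_measurable lebesgue {1/6..1/2} (\<lambda>t. h (t * (t - 1/6))) \<and>
     set_borel_measurable lebesgue {1/2..5/6} (\<lambda>t. h (t * (5/6 - t))) \<and>
     set_borel_measurable lebesgue {5/6..1} (\<lambda>t. h (t * (t - 5/6))) \<and>
     set_borel_measurable lebesgue {0..1/6} (\<lambda>t. h ((1 - t) * (1/6 - t))) \<and>
     set_borel_measurable lebesgue {1/6..1/2} (\<lambda>t. h ((1 - t) * (t - 1/6))) \<and>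
     set_borel_measurable lebesgue {1/2..5/6} (\<lambda>t. h ((1 - t) * (5/6 - t))) \<and>
     set_borel_measurable lebesgue {5/6..1} (\<lambda>t. h ((1 - t) * (t - 5/6)))"

end

theory Submission
  imports Defs
begin

text \<open>Integration by parts, separately on \<open>[0, 1/2]\<close> and \<open>[1/2, 1]\<close>, writes the Simpson error as
  \<open>(b - a)\<close> times the integral over \<open>[0, 1]\<close> of \<open>p t * f' (t * a + (1 - t) * b)\<close>, where
  \<open>p t = t - 1/6\<close> on the first half and \<open>p t = t - 5/6\<close> on the second. Then
  \<open>\<bar>p t\<bar> * h t \<le> h \<bar>p t\<bar> * h t \<le> h (\<bar>p t\<bar> * t)\<close>, and likewise for \<open>1 - t\<close>, so \<open>h\<close>-convexity
  bounds the integrand pointwise on each of the four intervals where \<open>p\<close> has constant sign.\<close>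

text \<open>If the right side is infinite there is nothing to prove. Otherwise \<open>F\<close>,
  being gauge integrable, is Lebesgue measurable, so the finite right side makes it Lebesgue
  integrable; the two integrals then agree and the usual norm bound applies. Working in
  [0, \<infinity>] lets divergent integrals of \<open>h\<close> pass through without a separate case
  later.\<close>

lemma abs_integral_le_nn_integral:
  fixes F :: "real \<Rightarrow> real"
  assumes F: "F integrable_on S"
  shows "ennreal \<bar>integral S F\<bar> \<le> (\<integral>\<^sup>+t\<in>S. ennreal \<bar>F t\<bar> \<partial>lebesgue)"
proof (cases "(\<integral>\<^sup>+t\<in>S. ennreal \<bar>F t\<bar> \<partial>lebesgue) < \<infinity>")
  case True
  have eq: "(\<integral>\<^sup>+t. ennreal (norm (indicator S t *\<^sub>R F t)) \<partial>lebesgue)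
      = (\<integral>\<^sup>+t\<in>S. ennreal \<bar>F t\<bar> \<partial>lebesgue)"
    by (rule nn_integral_cong) (auto simp: indicator_def)
  have "set_borel_measurable lebesgue S F"
    unfolding set_borel_measurable_def
    by (rule has_integral_implies_lebesgue_measurable[OF integrable_integral[OF F]])
  then have int: "set_integrable lebesgue S F"
    unfolding set_integrable_def set_borel_measurable_def
    using True eq by (simp add: integrable_iff_bounded)
  have "\<bar>integral S F\<bar> = norm (integral\<^sup>L lebesgue (\<lambda>t. indicator S t *\<^sub>R F t))"
    using set_lebesgue_integral_eq_integral(2)[OF int] by (simp add: set_lebesgue_integral_def)
  also have "ennreal \<dots> \<le> (\<integral>\<^sup>+t. ennreal (norm (indicator S t *\<^sub>R F t)) \<partial>lebesgue)"
    using int unfolding set_integrable_def by (rule integral_norm_bound_ennreal)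
  finally show ?thesis
    unfolding eq .
next
  case False
  then show ?thesis by (simp add: not_less top_unique)
qed

text \<open>Integrates a pointwise bound that is known only inside the interval. Measurability of
  \<open>H\<close> and \<open>K\<close> enters when the integral of the majorant is split into two,
  since additivity can fail without it.\<close>

lemma abs_integral_le_nn_integral_combination:
  fixes F H K :: "real \<Rightarrow> real"
  assumes F: "F integrable_on {l..u}"
    and H: "set_borel_measurable lebesgue {l..u} H" and K: "set_borel_measurable lebesgue {l..u} K"
    and nonneg: "\<And>t. t \<in> {l<..<u} \<Longrightarrow> 0 \<le> H t \<and> 0 \<le> K t" "0 \<le> \<alpha>" "0 \<le> \<beta>"
    and le: "\<And>t. t \<in> {l<..<u} \<Longrightarrow> \<bar>F t\<bar> \<le> \<alpha> * H t + \<beta> * K t"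
  shows "ennreal \<bar>integral {l..u} F\<bar> \<le>
    ennreal \<alpha> * (\<integral>\<^sup>+t\<in>{l..u}. ennreal (H t) \<partial>lebesgue) +
    ennreal \<beta> * (\<integral>\<^sup>+t\<in>{l..u}. ennreal (K t) \<partial>lebesgue)"
proof -
  have meas: "(\<lambda>t. ennreal (G t) * indicator {l..u} t) \<in> borel_measurable lebesgue"
    if "set_borel_measurable lebesgue {l..u} G" for G :: "real \<Rightarrow> real"
  proof -
    have "(\<lambda>t. ennreal (indicator {l..u} t *\<^sub>R G t)) \<in> borel_measurable lebesgue"
      using that unfolding set_borel_measurable_def by measurable
    moreover have "(\<lambda>t. ennreal (indicator {l..u} t *\<^sub>R G t))
        = (\<lambda>t. ennreal (G t) * indicator {l..u} t)"
      by (auto simp: indicator_def)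
    ultimately show ?thesis by simp
  qed
  \<comment> \<open>The endpoints are discarded as a null set: there the argument of
    \<open>h\<close> may be 0, a point that \<open>J\<close> may omit, so neither the sign of
    \<open>h\<close> nor the bound is available.\<close>
  have "{l, u} \<in> null_sets lebesgue"
    by (simp add: finite_imp_null_set_lborel null_sets_completionI)
  then have "AE t in lebesgue. t \<notin> {l, u}"
    by (rule AE_not_in)
  then have "AE t in lebesgue. ennreal \<bar>F t\<bar> * indicator {l..u} t \<le>
      ennreal \<alpha> * (ennreal (H t) * indicator {l..u} t) +
      ennreal \<beta> * (ennreal (K t) * indicator {l..u} t)"
  proof eventually_elim
    case (elim t)
    show ?case
    proof (cases "t \<in> {l..u}")
      case True
      with elim have t: "t \<in> {l<..<u}" by auto
      show ?thesis
        using le[OF t] nonneg(1)[OF t] nonneg(2,3) True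
        by (auto simp: ennreal_mult[symmetric] ennreal_plus[symmetric] simp del: ennreal_plus
            intro!: ennreal_leI)
    qed simp
  qed
  then have "(\<integral>\<^sup>+t\<in>{l..u}. ennreal \<bar>F t\<bar> \<partial>lebesgue) \<le>
      (\<integral>\<^sup>+t. ennreal \<alpha> * (ennreal (H t) * indicator {l..u} t) +
        ennreal \<beta> * (ennreal (K t) * indicator {l..u} t) \<partial>lebesgue)"
    by (rule nn_integral_mono_AE)
  also have "\<dots> = ennreal \<alpha> * (\<integral>\<^sup>+t\<in>{l..u}. ennreal (H t) \<partial>lebesgue) +
      ennreal \<beta> * (\<integral>\<^sup>+t\<in>{l..u}. ennreal (K t) \<partial>lebesgue)"
    using meas[OF H] meas[OF K] by (subst nn_integral_add) (auto simp: nn_integral_cmult)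
  finally show ?thesis
    using abs_integral_le_nn_integral[OF F] order_trans by blast
qed

text \<open>The function \<open>(t - c) * \<phi> t\<close> has derivative
  \<open>\<phi> t + (t - c) * \<psi> t\<close>. The fundamental theorem for the gauge integral gives
  both the integrability and the integral of this derivative; subtracting the continuous
  \<open>\<phi>\<close> leaves the weighted term.\<close>

lemma integration_by_parts_linear_weight:
  fixes \<phi> \<psi> :: "real \<Rightarrow> real"
  assumes "l \<le> u" and deriv: "\<And>t. t \<in> {l..u} \<Longrightarrow> (\<phi> has_real_derivative \<psi> t) (at t)"
  shows "((\<lambda>t. (t - c) * \<psi> t) has_integral
    (u - c) * \<phi> u - (l - c) * \<phi> l - integral {l..u} \<phi>) {l..u}"
proof -
  have "continuous_on {l..u} \<phi>"
    using deriv by (meson DERIV_isCont continuous_at_imp_continuous_on)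
  then have \<phi>: "(\<phi> has_integral integral {l..u} \<phi>) {l..u}"
    using integrable_continuous_real integrable_integral by blast
  have "((\<lambda>t. \<phi> t + (t - c) * \<psi> t) has_integral (u - c) * \<phi> u - (l - c) * \<phi> l) {l..u}"
    using \<open>l \<le> u\<close>
  proof (rule fundamental_theorem_of_calculus)
    fix t assume "t \<in> {l..u}"
    then have "((\<lambda>t. (t - c) * \<phi> t) has_real_derivative \<phi> t + (t - c) * \<psi> t) (at t)"
      using deriv by (auto intro!: derivative_eq_intros)
    then show "((\<lambda>t. (t - c) * \<phi> t) has_vector_derivative \<phi> t + (t - c) * \<psi> t) (at t within {l..u})"
      by (simp add: has_real_derivative_iff_has_vector_derivative has_vector_derivative_at_within)
  qed
  from has_integral_diff[OF this \<phi>] show ?thesis by simp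
qed

text \<open>A separate \<open>r\<close> for the absolute value of \<open>p\<close> lets each use
  supply its explicit affine form. The strict bounds keep \<open>t\<close>, \<open>1 - t\<close>,
  \<open>r\<close> and the products with \<open>r\<close> in (0,1), hence in \<open>J\<close>, as
  \<open>supermultiplicative_on\<close> demands.\<close>

lemma abs_weighted_convex_le:
  assumes J: "{0<..<1} \<subseteq> J" and pos: "\<And>x. x \<in> J \<Longrightarrow> 0 \<le> h x"
    and sup: "supermultiplicative_on J h" and id_le: "\<And>\<alpha>. \<alpha> \<in> {0<..<1} \<Longrightarrow> \<alpha> \<le> h \<alpha>"
    and conv: "h_convex_on h S (\<lambda>x. \<bar>g x\<bar>)" and ab: "a \<in> S" "b \<in> S"
    and t: "0 < t" "t < 1" and p: "\<bar>p\<bar> = r" "0 < r" "r < 1"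
  shows "\<bar>p * g (t * a + (1 - t) * b)\<bar> \<le> \<bar>g a\<bar> * h (t * r) + \<bar>g b\<bar> * h ((1 - t) * r)"
    and "0 \<le> h (t * r)" and "0 \<le> h ((1 - t) * r)"
proof -
  have prod_in: "s * r \<in> {0<..<1}" if "s \<in> {0<..<1}" for s
    using that p mult_strict_mono[of s 1 r 1] by simp
  have weight: "r * h s \<le> h (s * r)" if s: "s \<in> {0<..<1}" for s
  proof -
    have "r * h s \<le> h r * h s"
      using id_le[of r] pos[of s] s p J by (auto intro!: mult_right_mono)
    also have "\<dots> \<le> h (r * s)"
      using sup prod_in[OF s] s p J unfolding supermultiplicative_on_def
      by (auto simp: mult.commute subset_iff)
    finally show ?thesis by (simp add: mult.commute)
  qed
  have "\<bar>p * g (t * a + (1 - t) * b)\<bar> = r * \<bar>g (t * a + (1 - t) * b)\<bar>"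
    using p by (simp add: abs_mult)
  also have "\<dots> \<le> r * (h t * \<bar>g a\<bar> + h (1 - t) * \<bar>g b\<bar>)"
    using conv ab t p unfolding h_convex_on_def by (intro mult_left_mono) auto
  also have "\<dots> = \<bar>g a\<bar> * (r * h t) + \<bar>g b\<bar> * (r * h (1 - t))"
    by (simp add: algebra_simps)
  also have "\<dots> \<le> \<bar>g a\<bar> * h (t * r) + \<bar>g b\<bar> * h ((1 - t) * r)"
    using weight[of t] weight[of "1 - t"] t by (intro add_mono mult_left_mono) auto
  finally show "\<bar>p * g (t * a + (1 - t) * b)\<bar> \<le> \<bar>g a\<bar> * h (t * r) + \<bar>g b\<bar> * h ((1 - t) * r)" .
  show "0 \<le> h (t * r)" "0 \<le> h ((1 - t) * r)"
    using prod_in[of t] prod_in[of "1 - t"] t J pos by auto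
qed

text \<open>Substitution along the segment run backwards from \<open>b\<close> to \<open>a\<close>.
  The slope \<open>a - b\<close> is negative, but only its absolute value enters the scaling factor,
  so no sign appears.\<close>

lemma integral_reflected_segment:
  fixes f :: "real \<Rightarrow> real"
  assumes "a < b" and "continuous_on {a..b} f"
  shows "integral {0..1} (\<lambda>t. f (t * a + (1 - t) * b)) = 1 / (b - a) * integral {a..b} f"
proof -
  have "(f has_integral integral {a..b} f) {a..b}"
    using assms(2) integrable_continuous_real integrable_integral by blast
  then have "((\<lambda>t. f ((a - b) *\<^sub>R t + b)) has_integral
      (1 / \<bar>a - b\<bar> ^ DIM(real)) *\<^sub>R integral {a..b} f)
      ((\<lambda>x. (1 / (a - b)) *\<^sub>R x + - ((1 / (a - b)) *\<^sub>R b)) ` cbox a b)"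
    using \<open>a < b\<close> by (intro has_integral_affinity) auto
  moreover have "(\<lambda>x. (1 / (a - b)) *\<^sub>R x + - ((1 / (a - b)) *\<^sub>R b)) ` cbox a b = {0..1}"
    using \<open>a < b\<close> image_affinity_atLeastAtMost[of "1 / (a - b)" "- (b / (a - b))" a b]
    by (simp add: diff_divide_distrib[symmetric])
  moreover have "(a - b) *\<^sub>R t + b = t * a + (1 - t) * b" for t
    by (simp add: algebra_simps)
  ultimately show ?thesis
    using \<open>a < b\<close> by (simp add: integral_unique)
qed

text \<open>The shifts 1/6 and 5/6 produce Simpson's weights as boundary terms:
  \<open>t - 1/6\<close> is -1/6 at 0 and 1/3 at 1/2, while \<open>t - 5/6\<close> is -1/3 at 1/2
  and 1/6 at 1. The outer ends thus get 1/6 each and the midpoint 1/3 + 1/3.\<close>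

lemma simpson_error_identity:
  fixes f f' :: "real \<Rightarrow> real"
  assumes "a < b" and deriv: "\<forall>x\<in>{a..b}. (f has_real_derivative f' x) (at x)"
  defines "F \<equiv> \<lambda>c t. (t - c) * f' (t * a + (1 - t) * b)"
  shows "F (1/6) integrable_on {0..1/2}" and "F (5/6) integrable_on {1/2..1}"
    and "1 / (b - a) * integral {a..b} f - 1/3 * ((f a + f b) / 2 + 2 * f ((a + b) / 2))
      = (b - a) * (integral {0..1/2} (F (1/6)) + integral {1/2..1} (F (5/6)))"
proof -
  define \<phi> where "\<phi> t = f (t * a + (1 - t) * b)" for t
  have seg: "t * a + (1 - t) * b \<in> {a..b}" if "t \<in> {0..1}" for t
    using convexD[OF convex_real_interval(5), of a a b b t "1 - t"] that \<open>a < b\<close> by simp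
  have d\<phi>: "(\<phi> has_real_derivative (a - b) * f' (t * a + (1 - t) * b)) (at t)"
    if "t \<in> {0..1}" for t
  proof -
    have "((\<lambda>t. t * a + (1 - t) * b) has_real_derivative (a - b)) (at t)"
      by (auto intro!: derivative_eq_intros)
    from DERIV_chain2[OF bspec[OF deriv seg[OF that]] this]
    show ?thesis by (simp add: \<phi>_def[abs_def] mult.commute)
  qed
  have parts: "(F c has_integral
      ((u - c) * \<phi> u - (l - c) * \<phi> l - integral {l..u} \<phi>) / (a - b)) {l..u}"
    if "0 \<le> l" "l \<le> u" "u \<le> 1" for c l u
  proof -
    have "((\<lambda>t. (t - c) * ((a - b) * f' (t * a + (1 - t) * b))) has_integral
        (u - c) * \<phi> u - (l - c) * \<phi> l - integral {l..u} \<phi>) {l..u}"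
      using that by (intro integration_by_parts_linear_weight d\<phi>) auto
    from has_integral_divide[OF this, of "a - b"] show ?thesis
      using \<open>a < b\<close> by (simp add: F_def)
  qed
  show int: "F (1/6) integrable_on {0..1/2}" "F (5/6) integrable_on {1/2..1}"
    using parts[of 0 "1/2"] parts[of "1/2" 1] by (auto simp: integrable_on_def)
  have "continuous_on {0..1} \<phi>"
    using d\<phi> by (meson DERIV_isCont continuous_at_imp_continuous_on)
  then have "integral {0..1/2} \<phi> + integral {1/2..1} \<phi> = integral {0..1} \<phi>"
    by (intro Henstock_Kurzweil_Integration.integral_combine integrable_continuous_real) auto
  also have "continuous_on {a..b} f"
    using deriv by (meson DERIV_isCont continuous_at_imp_continuous_on)
  then have "integral {0..1} \<phi> = 1 / (b - a) * integral {a..b} f"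
    unfolding \<phi>_def by (rule integral_reflected_segment[OF \<open>a < b\<close>])
  finally have mean: "integral {0..1/2} \<phi> + integral {1/2..1} \<phi> = 1 / (b - a) * integral {a..b} f" .
  \<comment> \<open>The chain rule leaves a divisor \<open>a - b\<close>; against the outer factor
    \<open>b - a\<close> it cancels to -1, which turns boundary terms minus mean into mean minus
    boundary terms.\<close>
  have scale: "(b - a) * (x / (a - b) + y / (a - b)) = - (x + y)" for x y
    using \<open>a < b\<close>
    by (simp add: add_divide_distrib[symmetric] divide_eq_eq) (simp add: algebra_simps)
  have "integral {0..1/2} (F (1/6)) + integral {1/2..1} (F (5/6)) =
      (1/3 * \<phi> (1/2) + 1/6 * \<phi> 0 - integral {0..1/2} \<phi>) / (a - b) +
      (1/6 * \<phi> 1 + 1/3 * \<phi> (1/2) - integral {1/2..1} \<phi>) / (a - b)"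
    using integral_unique[OF parts[of 0 "1/2" "1/6"]] integral_unique[OF parts[of "1/2" 1 "5/6"]]
    by simp
  also have "(b - a) * \<dots> = integral {0..1/2} \<phi> + integral {1/2..1} \<phi> -
      (2/3 * \<phi> (1/2) + 1/6 * \<phi> 0 + 1/6 * \<phi> 1)"
    unfolding scale by simp
  also have "\<dots> = 1 / (b - a) * integral {a..b} f -
      (2/3 * f ((a + b) / 2) + 1/6 * f b + 1/6 * f a)"
    unfolding mean by (simp add: \<phi>_def add_divide_distrib)
  finally show "1 / (b - a) * integral {a..b} f - 1/3 * ((f a + f b) / 2 + 2 * f ((a + b) / 2))
      = (b - a) * (integral {0..1/2} (F (1/6)) + integral {1/2..1} (F (5/6)))"
    by (simp add: add_divide_distrib)
qed

theorem theorem4: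
  fixes J I :: "real set" and h f f' :: "real \<Rightarrow> real" and a b :: real
  assumes "is_interval J" and "{0<..<1} \<subseteq> J"
    and "\<And>x. x \<in> J \<Longrightarrow> 0 \<le> h x"
    and "supermultiplicative_on J h"
    and "\<And>\<alpha>. \<alpha> \<in> {0<..<1} \<Longrightarrow> \<alpha> \<le> h \<alpha>"
    and "simpson_integrals_defined h"
    and "is_interval I" and "I \<subseteq> {0..}"
    and "\<And>x. x \<in> interior I \<Longrightarrow> (f has_real_derivative f' x) (at x)"
    and "a \<in> interior I" and "b \<in> interior I" and "a < b"
    and "f' absolutely_integrable_on {a..b}"
    and "h_convex_on h I (\<lambda>x. \<bar>f' x\<bar>)"
  shows "ennreal \<bar>1 / (b - a) * integral {a..b} f
            - 1/3 * ((f a + f b) / 2 + 2 * f ((a + b) / 2))\<bar>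
         \<le> ennreal (b - a) *
            (ennreal \<bar>f' a\<bar> * simpson_A h + ennreal \<bar>f' b\<bar> * simpson_B h)"
proof -
  note h = assms(2-5)
  have ab: "a \<in> I" "b \<in> I" using assms(10,11) interior_subset by auto
  have "is_interval (interior I)"
    using assms(7) convex_interior is_interval_convex_1 by blast
  then have "x \<in> interior I" if "x \<in> {a..b}" for x
    using mem_is_interval_1_I[of "interior I" a b x] assms(10,11) that by simp
  then have deriv: "\<forall>x\<in>{a..b}. (f has_real_derivative f' x) (at x)"
    using assms(9) by blast
  define F where "F c t = (t - c) * f' (t * a + (1 - t) * b)" for c t
  note simpson = simpson_error_identity[OF assms(12) deriv, folded F_def]
  \<comment> \<open>The extra cuts at 1/6 and 5/6 are the zeros of the weights, so that the sign is
    constant on each piece.\<close>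
  have int: "F (1/6) integrable_on {0..1/6}" "F (1/6) integrable_on {1/6..1/2}"
    "F (5/6) integrable_on {1/2..5/6}" "F (5/6) integrable_on {5/6..1}"
    by (rule integrable_on_subinterval[OF simpson(1)] integrable_on_subinterval[OF simpson(2)]; simp)+
  note meas = assms(6)[unfolded simpson_integrals_defined_def]
  \<comment> \<open>One estimate serves all four pieces: \<open>r\<close> stands for
    \<open>t - c\<close> or \<open>c - t\<close>, whichever is positive inside the piece.\<close>
  have bound: "ennreal \<bar>integral {l..u} (F c)\<bar> \<le>
      ennreal \<bar>f' a\<bar> * (\<integral>\<^sup>+t\<in>{l..u}. ennreal (h (t * r t)) \<partial>lebesgue) +
      ennreal \<bar>f' b\<bar> * (\<integral>\<^sup>+t\<in>{l..u}. ennreal (h ((1 - t) * r t)) \<partial>lebesgue)"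
    if "F c integrable_on {l..u}" "set_borel_measurable lebesgue {l..u} (\<lambda>t. h (t * r t))"
      "set_borel_measurable lebesgue {l..u} (\<lambda>t. h ((1 - t) * r t))"
      "0 \<le> l" "u \<le> 1" "\<And>t. t \<in> {l<..<u} \<Longrightarrow> \<bar>t - c\<bar> = r t \<and> 0 < r t \<and> r t < 1" for c l u r
  proof (rule abs_integral_le_nn_integral_combination[OF that(1-3)])
    fix t assume t: "t \<in> {l<..<u}"
    have t01: "0 < t" "t < 1" using t that(4,5) by auto
    have r: "\<bar>t - c\<bar> = r t" "0 < r t" "r t < 1" using that(6)[OF t] by auto
    note conv = abs_weighted_convex_le[OF h assms(14) ab t01 r]
    show "0 \<le> h (t * r t) \<and> 0 \<le> h ((1 - t) * r t)" using conv(2,3) ..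
    show "\<bar>F c t\<bar> \<le> \<bar>f' a\<bar> * h (t * r t) + \<bar>f' b\<bar> * h ((1 - t) * r t)"
      unfolding F_def by (rule conv(1))
  qed simp_all
  have bounds:
    "ennreal \<bar>integral {0..1/6} (F (1/6))\<bar> \<le>
      ennreal \<bar>f' a\<bar> * (\<integral>\<^sup>+t\<in>{0..1/6}. ennreal (h (t * (1/6 - t))) \<partial>lebesgue) +
      ennreal \<bar>f' b\<bar> * (\<integral>\<^sup>+t\<in>{0..1/6}. ennreal (h ((1 - t) * (1/6 - t))) \<partial>lebesgue)"
    "ennreal \<bar>integral {1/6..1/2} (F (1/6))\<bar> \<le>
      ennreal \<bar>f' a\<bar> * (\<integral>\<^sup>+t\<in>{1/6..1/2}. ennreal (h (t * (t - 1/6))) \<partial>lebesgue) +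
      ennreal \<bar>f' b\<bar> * (\<integral>\<^sup>+t\<in>{1/6..1/2}. ennreal (h ((1 - t) * (t - 1/6))) \<partial>lebesgue)"
    "ennreal \<bar>integral {1/2..5/6} (F (5/6))\<bar> \<le>
      ennreal \<bar>f' a\<bar> * (\<integral>\<^sup>+t\<in>{1/2..5/6}. ennreal (h (t * (5/6 - t))) \<partial>lebesgue) +
      ennreal \<bar>f' b\<bar> * (\<integral>\<^sup>+t\<in>{1/2..5/6}. ennreal (h ((1 - t) * (5/6 - t))) \<partial>lebesgue)"
    "ennreal \<bar>integral {5/6..1} (F (5/6))\<bar> \<le>
      ennreal \<bar>f' a\<bar> * (\<integral>\<^sup>+t\<in>{5/6..1}. ennreal (h (t * (t - 5/6))) \<partial>lebesgue) +
      ennreal \<bar>f' b\<bar> * (\<integral>\<^sup>+t\<in>{5/6..1}. ennreal (h ((1 - t) * (t - 5/6))) \<partial>lebesgue)"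
    by ((rule bound[OF int(1)] bound[OF int(2)] bound[OF int(3)] bound[OF int(4)]),
        (simp only: meas), (simp only: meas), simp, simp, force)+
  have split: "integral {0..1/2} (F (1/6)) =
      integral {0..1/6} (F (1/6)) + integral {1/6..1/2} (F (1/6))"
    "integral {1/2..1} (F (5/6)) =
      integral {1/2..5/6} (F (5/6)) + integral {5/6..1} (F (5/6))"
    using simpson(1,2)
    by (simp_all add: Henstock_Kurzweil_Integration.integral_combine)
  \<comment> \<open>With the integrals as atoms, the next estimate is the triangle inequality for
    four real numbers.\<close>
  define i where "i = (\<lambda>l u c. integral {l..u} (F c))"
  have "\<bar>1 / (b - a) * integral {a..b} f - 1/3 * ((f a + f b) / 2 + 2 * f ((a + b) / 2))\<bar> =
      (b - a) * \<bar>i 0 (1/6) (1/6) + i (1/6) (1/2) (1/6) + (i (1/2) (5/6) (5/6) + i (5/6) 1 (5/6))\<bar>"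
    unfolding simpson(3) split i_def using assms(12) by (simp only: abs_mult)
  also have "\<dots> \<le> (b - a) *
      (\<bar>i 0 (1/6) (1/6)\<bar> + \<bar>i (1/6) (1/2) (1/6)\<bar> + \<bar>i (1/2) (5/6) (5/6)\<bar> + \<bar>i (5/6) 1 (5/6)\<bar>)"
    using assms(12) by (intro mult_left_mono) auto
  \<comment> \<open>The passage to [0, \<infinity>] respects the sum and the product because every
    term and the factor \<open>b - a\<close> are nonnegative.\<close>
  finally have "ennreal \<bar>1 / (b - a) * integral {a..b} f
        - 1/3 * ((f a + f b) / 2 + 2 * f ((a + b) / 2))\<bar> \<le> ennreal (b - a) *
      (ennreal \<bar>i 0 (1/6) (1/6)\<bar> + ennreal \<bar>i (1/6) (1/2) (1/6)\<bar> +
       ennreal \<bar>i (1/2) (5/6) (5/6)\<bar> + ennreal \<bar>i (5/6) 1 (5/6)\<bar>)"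
    using assms(12)
    by (simp add: ennreal_mult[symmetric] ennreal_plus[symmetric] ennreal_leI del: ennreal_plus)
  also have "\<dots> \<le> ennreal (b - a) *
      (ennreal \<bar>f' a\<bar> * simpson_A h + ennreal \<bar>f' b\<bar> * simpson_B h)"
  proof (rule mult_left_mono)
    \<comment> \<open>The eight integrals are regrouped by piece instead of by endpoint, to match
      the four bounds term by term.\<close>
    have "ennreal \<bar>f' a\<bar> * simpson_A h + ennreal \<bar>f' b\<bar> * simpson_B h =
      (ennreal \<bar>f' a\<bar> * (\<integral>\<^sup>+t\<in>{0..1/6}. ennreal (h (t * (1/6 - t))) \<partial>lebesgue) +
       ennreal \<bar>f' b\<bar> * (\<integral>\<^sup>+t\<in>{0..1/6}. ennreal (h ((1 - t) * (1/6 - t))) \<partial>lebesgue)) +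
      (ennreal \<bar>f' a\<bar> * (\<integral>\<^sup>+t\<in>{1/6..1/2}. ennreal (h (t * (t - 1/6))) \<partial>lebesgue) +
       ennreal \<bar>f' b\<bar> * (\<integral>\<^sup>+t\<in>{1/6..1/2}. ennreal (h ((1 - t) * (t - 1/6))) \<partial>lebesgue)) +
      (ennreal \<bar>f' a\<bar> * (\<integral>\<^sup>+t\<in>{1/2..5/6}. ennreal (h (t * (5/6 - t))) \<partial>lebesgue) +
       ennreal \<bar>f' b\<bar> * (\<integral>\<^sup>+t\<in>{1/2..5/6}. ennreal (h ((1 - t) * (5/6 - t))) \<partial>lebesgue)) +
      (ennreal \<bar>f' a\<bar> * (\<integral>\<^sup>+t\<in>{5/6..1}. ennreal (h (t * (t - 5/6))) \<partial>lebesgue) +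
       ennreal \<bar>f' b\<bar> * (\<integral>\<^sup>+t\<in>{5/6..1}. ennreal (h ((1 - t) * (t - 5/6))) \<partial>lebesgue))"
      unfolding simpson_A_def simpson_B_def by (simp only: distrib_left ac_simps)
    then show "ennreal \<bar>i 0 (1/6) (1/6)\<bar> + ennreal \<bar>i (1/6) (1/2) (1/6)\<bar> +
        ennreal \<bar>i (1/2) (5/6) (5/6)\<bar> + ennreal \<bar>i (5/6) 1 (5/6)\<bar>
      \<le> ennreal \<bar>f' a\<bar> * simpson_A h + ennreal \<bar>f' b\<bar> * simpson_B h"
      unfolding i_def by (simp only:) (intro add_mono bounds)
  qed simp
  finally show ?thesis .
qed

end
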